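(* Let $W,T\in\mathbb{R}^{n\times n}$ be symmetric positive definite and symmetric, respectively, and let $S=W^{-1}T$, with spectral radius $\rho(S)$. Let $\alpha$ be a nonzero real number. Then the GSOR method with parameter $\alpha$ for solving $$\begin{pmatrix} W & -T\\ T & W\end{pmatrix}\begin{pmatrix} x \\ y \end{pmatrix}=\begin{pmatrix} p \\ q \end{pmatrix}$$ is convergent if and only if $$0<\alpha<\frac{2}{1+\rho(S)}.$$
   Context: Here $p,q\in\mathbb{R}^n$ are given vectors. The real $2n\times 2n$ system is the real equivalent form of the complex system $(W+iT)(x+iy)=p+iq$, with $i=\sqrt{-1}$. For $0\neq\alpha\in\mathbb{R}$ and initial approximations $x^{(0)},y^{(0)}\in\mathbb{R}^n$, the GSOR (generalized successive overrelaxation) method is the iteration, for $k=0,1,2,\dots$, $$W x^{(k+1)}=(1-\alpha)W x^{(k)}+\alpha T y^{(k)}+\alpha p,$$ $$W y^{(k+1)}=-\alpha T x^{(k+1)}+(1-\alpha)W y^{(k)}+\alpha q.$$ Its iteration matrix is $$\mathcal{G}_\alpha=\begin{pmatrix} I & 0\\ \alpha S & I\end{pmatrix}^{-1}\begin{pmatrix}(1-\alpha)I & \alpha S\\ 0 & (1-\alpha)I\end{pmatrix},\qquad S=W^{-1}T,$$ where $I$ is the $n\times n$ identity matrix. The method is called convergent if for every choice of initial vectors the iterates converge to the solution of the system, equivalently if the spectral radius satisfies $\rho(\mathcal{G}_\alpha)<1$. *)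

theory Defs
  imports "HOL-Analysis.Analysis"
begin

definition symmetric_mat :: "real^'n^'n \<Rightarrow> bool" where
  "symmetric_mat A \<longleftrightarrow> transpose A = A"

definition pos_def_mat :: "real^'n^'n \<Rightarrow> bool" where
  "pos_def_mat A \<longleftrightarrow> (\<forall>x. x \<noteq> 0 \<longrightarrow> 0 < x \<bullet> (A *v x))"

definition spectrum_mat :: "real^'n^'n \<Rightarrow> complex set" where
  "spectrum_mat A =
     {z. \<exists>v::complex^'n. v \<noteq> 0 \<and> map_matrix complex_of_real A *v v = z *s v}"

definition spectral_radius_mat :: "real^'n^'n \<Rightarrow> real" where
  "spectral_radius_mat A = Max (norm ` spectrum_mat A)"

definition block_solution ::
  "real^'n^'n \<Rightarrow> real^'n^'n \<Rightarrow> real^'n \<Rightarrow> real^'n \<Rightarrow> real^'n \<Rightarrow> real^'n \<Rightarrow> bool" where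
  "block_solution W T p q x y \<longleftrightarrow> W *v x - T *v y = p \<and> T *v x + W *v y = q"

definition gsor_iterates ::
  "real^'n^'n \<Rightarrow> real^'n^'n \<Rightarrow> real \<Rightarrow> real^'n \<Rightarrow> real^'n
    \<Rightarrow> (nat \<Rightarrow> real^'n) \<Rightarrow> (nat \<Rightarrow> real^'n) \<Rightarrow> bool" where
  "gsor_iterates W T \<alpha> p q x y \<longleftrightarrow>
     (\<forall>k. W *v x (Suc k) = (1 - \<alpha>) *\<^sub>R (W *v x k) + \<alpha> *\<^sub>R (T *v y k) + \<alpha> *\<^sub>R p \<and>
          W *v y (Suc k) = - (\<alpha> *\<^sub>R (T *v x (Suc k))) + (1 - \<alpha>) *\<^sub>R (W *v y k) + \<alpha> *\<^sub>R q)"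

text \<open>The initial vectors are \<open>x 0\<close> and \<open>y 0\<close>, so quantifying over all sequences
  that satisfy the recursion quantifies over all initial vectors; for invertible \<open>W\<close>
  each pair of initial vectors determines exactly one such pair of sequences
  (\<open>gsor_iterates_exist\<close>, \<open>gsor_iterates_unique\<close>).\<close>

definition gsor_convergent ::
  "real^'n^'n \<Rightarrow> real^'n^'n \<Rightarrow> real \<Rightarrow> real^'n \<Rightarrow> real^'n \<Rightarrow> bool" where
  "gsor_convergent W T \<alpha> p q \<longleftrightarrow>
     (\<exists>xs ys. block_solution W T p q xs ys \<and>
        (\<forall>x y. gsor_iterates W T \<alpha> p q x y \<longrightarrow> x \<longlonglongrightarrow> xs \<and> y \<longlonglongrightarrow> ys))"

lemma pos_def_mat_invertible:
  fixes A :: "real^'n^'n"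
  assumes "pos_def_mat A"
  shows "invertible A"
proof -
  have "x = 0" if "A *v x = 0" for x
    using assms that by (force simp: pos_def_mat_def)
  then show ?thesis
    by (auto simp: invertible_left_inverse matrix_left_invertible_ker)
qed

lemma gsor_iterates_exist:
  fixes W T :: "real^'n^'n"
  assumes "invertible W"
  shows "\<exists>x y. x 0 = x0 \<and> y 0 = y0 \<and> gsor_iterates W T \<alpha> p q x y"
proof -
  obtain R where "W ** R = mat 1"
    using assms by (auto simp: invertible_def)
  then have W: "W *v (R *v v) = v" for v
    by (simp add: matrix_vector_mul_assoc)
  define X where "X = (\<lambda>(a, b). R *v
    ((1 - \<alpha>) *\<^sub>R (W *v a) + \<alpha> *\<^sub>R (T *v b) + \<alpha> *\<^sub>R p))"
  define Y where "Y = (\<lambda>u. R *v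
    (- (\<alpha> *\<^sub>R (T *v X u)) + (1 - \<alpha>) *\<^sub>R (W *v snd u) + \<alpha> *\<^sub>R q))"
  define s where "s k = ((\<lambda>u. (X u, Y u)) ^^ k) (x0, y0)" for k
  have "gsor_iterates W T \<alpha> p q (\<lambda>k. fst (s k)) (\<lambda>k. snd (s k))"
    unfolding gsor_iterates_def by (simp add: s_def X_def Y_def W case_prod_unfold)
  moreover have "s 0 = (x0, y0)" by (simp add: s_def)
  ultimately show ?thesis
    by (intro exI[of _ "\<lambda>k. fst (s k)"] exI[of _ "\<lambda>k. snd (s k)"]) simp
qed

lemma gsor_iterates_unique:
  fixes W T :: "real^'n^'n"
  assumes "invertible W"
    and "gsor_iterates W T \<alpha> p q x y" "gsor_iterates W T \<alpha> p q x' y'"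
    and "x 0 = x' 0" "y 0 = y' 0"
  shows "x k = x' k \<and> y k = y' k"
proof (induction k)
  case 0
  show ?case using assms by simp
next
  case (Suc k)
  have inj: "a = b" if "W *v a = W *v b" for a b
    using assms(1) that inj_matrix_vector_mult by (metis injD)
  have x: "x (Suc k) = x' (Suc k)"
    by (rule inj) (use assms(2,3) Suc in \<open>simp add: gsor_iterates_def\<close>)
  have y: "y (Suc k) = y' (Suc k)"
    by (rule inj) (use assms(2,3) Suc x in \<open>simp add: gsor_iterates_def\<close>)
  show ?case using x y ..
qed

end

theory Submission
  imports Defs
begin

text \<open>
  The matrix \<open>S = W\<^sup>-\<^sup>1 T\<close> is in general not symmetric, but it is self-adjoint for the inner
  product \<open>B x y = x \<bullet> W y\<close>. Throughout, \<open>d = (1 - \<alpha>)\<^sup>2\<close>, and \<open>e\<close>, \<open>f\<close> are the errors of the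
  two components of the iterates. Subtracting the solution from the iteration gives
  \<open>e' = (1 - \<alpha>) e + \<alpha> S f\<close> and \<open>f' = (1 - \<alpha>) f - \<alpha> S e'\<close> (\<open>gsor_iterates_iff_error\<close>).

  Maximising \<open>B (S x) (S x) / B x x\<close> yields a real eigenvector \<open>v\<close>, \<open>S v = \<mu> v\<close>, for which
  \<open>\<bar>\<mu>\<bar>\<close> is at once the norm of \<open>S\<close> with respect to \<open>B\<close> and the spectral radius of \<open>S\<close>
  (\<open>extremal_eigenvector\<close>, \<open>spectral_radius_extremal\<close>). The condition to be characterised is thus
  \<open>0 < \<alpha>\<close> and \<open>\<alpha> (1 + \<bar>\<mu>\<bar>) < 2\<close>.

  Sufficiency: eliminating one of the two errors shows that \<open>e\<close> and \<open>f\<close> both satisfy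
  \<open>u'' = P u' - d u\<close> with the self-adjoint operator \<open>P = 2 (1 - \<alpha>) - \<alpha>\<^sup>2 S\<^sup>2\<close>. The condition on
  \<open>\<alpha>\<close> says precisely that \<open>d < 1\<close> and that the quadratic form of \<open>P\<close> stays strictly between
  \<open>-(1 + d)\<close> and \<open>1 + d\<close>; these are the Schur-Cohn conditions for the roots of \<open>z\<^sup>2 - t z + d\<close>
  with \<open>t\<close> in the numerical range of \<open>P\<close>. An explicit Lyapunov function then
  forces \<open>u\<close> to zero without diagonalising \<open>S\<close> (\<open>second_order_recurrence_tendsto_zero\<close>).

  Necessity: errors that start in multiples of \<open>v\<close> remain there, so the coefficients obey a
  two-dimensional real recursion whose solutions must all tend to zero. Its matrix has determinant
  \<open>d\<close> and trace \<open>2 (1 - \<alpha>) - \<alpha>\<^sup>2 \<mu>\<^sup>2\<close>. The determinant must be less than one, which gives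
  \<open>0 < \<alpha> < 2\<close>; and if \<open>\<alpha> (1 + \<bar>\<mu>\<bar>) \<ge> 2\<close>, the matrix has a real eigenvalue \<open>\<le> -1\<close>
  (\<open>scalar_gsor_necessary\<close>).
\<close>

section \<open>Self-adjoint operators for a positive definite form\<close>

text \<open>
  A second inner product on a Euclidean space. It is compared with the standard one through
  compactness of the unit sphere, so topological notions can refer to the given norm.
\<close>

locale definite_form = bounded_bilinear B
  for B :: "'a::euclidean_space \<Rightarrow> 'a \<Rightarrow> real" +
  assumes sym: "B x y = B y x"
    and pos: "x \<noteq> 0 \<Longrightarrow> 0 < B x x"
begin

lemma nonneg: "0 \<le> B x x"
  using pos[of x] by (cases "x = 0") (auto simp: zero_left)

lemma eq_zero_iff: "B x x = 0 \<longleftrightarrow> x = 0"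
  using pos[of x] by (cases "x = 0") (auto simp: zero_left)

lemma sphere_nonempty: "sphere (0::'a) 1 \<noteq> {}"
proof -
  obtain b :: 'a where "b \<in> Basis" using nonempty_Basis by blast
  then have "b \<in> sphere 0 1" by simp
  then show ?thesis by blast
qed

lemma coercive: "\<exists>c>0. \<forall>x. c * (norm x)\<^sup>2 \<le> B x x"
proof -
  have cont: "continuous_on (sphere 0 1) (\<lambda>x. B x x)"
    by (intro continuous_on continuous_on_id)
  obtain m where m: "m \<in> sphere 0 1" "\<And>y. y \<in> sphere 0 1 \<Longrightarrow> B m m \<le> B y y"
    using continuous_attains_inf[OF compact_sphere sphere_nonempty cont] by blast
  have "B m m * (norm x)\<^sup>2 \<le> B x x" for x
  proof (cases "x = 0")
    case False
    then have "B m m \<le> B (x /\<^sub>R norm x) (x /\<^sub>R norm x)"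
      by (intro m) simp
    also have "\<dots> = B x x / (norm x)\<^sup>2"
      by (simp add: scaleR_left scaleR_right power2_eq_square divide_inverse)
    finally show ?thesis using False by (simp add: field_simps)
  qed (simp add: zero_left)
  moreover have "0 < B m m" using m(1) by (intro pos) auto
  ultimately show ?thesis by blast
qed

lemma tendsto_zeroI:
  assumes "(\<lambda>k. B (u k) (u k)) \<longlonglongrightarrow> 0"
  shows "u \<longlonglongrightarrow> 0"
proof -
  obtain c where c: "c > 0" "\<And>x. c * (norm x)\<^sup>2 \<le> B x x" using coercive by blast
  have "(\<lambda>k. B (u k) (u k) / c) \<longlonglongrightarrow> 0" using tendsto_divide_zero[OF assms] .
  then have "(\<lambda>k. (norm (u k))\<^sup>2) \<longlonglongrightarrow> 0"
    by (rule tendsto_sandwich[rotated 3, where f = "\<lambda>_. 0"])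
      (use c in \<open>auto simp: field_simps\<close>)
  then show ?thesis
    by (simp add: tendsto_norm_zero_iff)
qed

lemma BseqI_form:
  assumes "\<And>k. B (u k) (u k) \<le> K"
  shows "Bseq u"
proof -
  obtain c where c: "c > 0" "\<And>x. c * (norm x)\<^sup>2 \<le> B x x" using coercive by blast
  have "norm (u k) \<le> sqrt (K / c)" for k
  proof (rule real_le_rsqrt)
    have "c * (norm (u k))\<^sup>2 \<le> K" using c(2)[of "u k"] assms[of k] by linarith
    then show "(norm (u k))\<^sup>2 \<le> K / c" using c(1) by (simp add: field_simps)
  qed
  then show ?thesis by (rule BseqI')
qed

text \<open>
  The Cauchy-Schwarz argument for a semidefinite form: if \<open>R v\<close> were nonzero, then moving from
  the minimiser \<open>v\<close> a little in the direction \<open>- R v\<close> would make the form negative.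
\<close>
lemma semidefinite_kernel:
  assumes R: "linear R" and adj: "\<And>x y. B (R x) y = B x (R y)"
    and semi: "\<And>x. 0 \<le> B (R x) x" and v: "B (R v) v = 0"
  shows "R v = 0"
proof (rule ccontr)
  assume "R v \<noteq> 0"
  define c where "c = B (R v) (R v)"
  define q where "q = B (R (R v)) (R v)"
  have c: "c > 0" using pos[OF \<open>R v \<noteq> 0\<close>] by (simp add: c_def)
  have q: "q \<ge> 0" using semi by (simp add: q_def)
  \<comment> \<open>\<open>- c / q\<close> would minimise \<open>2 s c + s\<^sup>2 q\<close>; adding one avoids a zero denominator.\<close>
  define s where "s = - c / (q + 1)"
  have "B (R (v + s *\<^sub>R R v)) (v + s *\<^sub>R R v) = 2 * s * c + s\<^sup>2 * q"
    using adj[of "R v" v]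
    by (simp add: linear_add[OF R] linear_scale[OF R] add_left add_right scaleR_left scaleR_right
        v c_def q_def algebra_simps power2_eq_square)
  also have "\<dots> = - c\<^sup>2 * (q + 2) / (q + 1)\<^sup>2"
  proof -
    have "q + 1 \<noteq> 0" using q by simp
    then show ?thesis by (simp add: s_def divide_simps power2_eq_square) (simp add: algebra_simps)
  qed
  also have "\<dots> < 0" using c q by (simp add: divide_neg_pos)
  finally show False using semi[of "v + s *\<^sub>R R v"] by linarith
qed

text \<open>
  If the quotient \<open>B (S x) (S x) / B x x\<close> has the maximum \<open>m\<^sup>2\<close>, attained at \<open>w\<close>, then
  \<open>m\<^sup>2 - S\<^sup>2\<close> is semidefinite and annihilates \<open>w\<close>. Since \<open>m\<^sup>2 - S\<^sup>2\<close> factors as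
  \<open>(m - S) (m + S)\<close>, either \<open>w\<close> is an eigenvector for \<open>- m\<close> or \<open>(S + m) w\<close> is one for \<open>m\<close>.
  Maximising the square of \<open>S\<close> rather than \<open>B (S x) x\<close> selects the eigenvalue of largest modulus
  whatever its sign.
\<close>
lemma extremal_eigenvector:
  assumes S: "linear S" and adj: "\<And>x y. B (S x) y = B x (S y)"
  obtains \<mu> v where "v \<noteq> 0" "S v = \<mu> *\<^sub>R v" "\<And>x. B (S x) (S x) \<le> \<mu>\<^sup>2 * B x x"
proof -
  have bl: "bounded_linear S" using S by (simp add: linear_conv_bounded_linear)
  have nz: "B x x \<noteq> 0" if "x \<in> sphere 0 1" for x using that by (auto simp: eq_zero_iff)
  have cont: "continuous_on (sphere 0 1) (\<lambda>x. B (S x) (S x) / B x x)"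
    by (intro continuous_on_divide continuous_on continuous_on_id
        bounded_linear.continuous_on[OF bl]) (use nz in auto)
  obtain w where w: "w \<in> sphere 0 1"
    "\<And>y. y \<in> sphere 0 1 \<Longrightarrow> B (S y) (S y) / B y y \<le> B (S w) (S w) / B w w"
    using continuous_attains_sup[OF compact_sphere sphere_nonempty cont] by blast
  define M where "M = B (S w) (S w) / B w w"
  have w0: "w \<noteq> 0" using w(1) by auto
  have M0: "0 \<le> M" by (simp add: M_def nonneg)
  have bound: "B (S x) (S x) \<le> M * B x x" for x
  proof (cases "x = 0")
    case False
    have "B (S (x /\<^sub>R norm x)) (S (x /\<^sub>R norm x)) / B (x /\<^sub>R norm x) (x /\<^sub>R norm x) \<le> M"
      unfolding M_def by (rule w) (use False in simp)
    then show ?thesis using False pos[OF False]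
      by (simp add: linear_scale[OF S] scaleR_left scaleR_right field_simps)
  qed (simp add: linear_0[OF S] zero_left)
  define m where "m = sqrt M"
  have m2: "m\<^sup>2 = M" using M0 by (simp add: m_def)
  let ?R = "\<lambda>x. M *\<^sub>R x - S (S x)"
  have "?R w = 0"
  proof (rule semidefinite_kernel[where R = ?R])
    show "linear ?R"
      by (intro linear_compose_sub linear_compose_scale_right linear_id[unfolded id_def]
          linear_compose[OF S S, unfolded o_def])
    show "B (?R x) y = B x (?R y)" for x y
      by (simp add: diff_left diff_right scaleR_left scaleR_right adj)
    show "0 \<le> B (?R x) x" for x
      using bound[of x] by (simp add: diff_left scaleR_left adj)
    show "B (?R w) w = 0"
      using w0 by (simp add: diff_left scaleR_left adj M_def eq_zero_iff)
  qed
  then have SSw: "S (S w) = (m * m) *\<^sub>R w" using m2 by (simp add: power2_eq_square)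
  show thesis
  proof (cases "S w = - m *\<^sub>R w")
    case True
    show ?thesis using that[OF w0 True] bound m2 by simp
  next
    case False
    have "S w + m *\<^sub>R w \<noteq> 0" using False by (metis eq_neg_iff_add_eq_0 scaleR_minus_left)
    moreover have "S (S w + m *\<^sub>R w) = m *\<^sub>R (S w + m *\<^sub>R w)"
      by (simp add: linear_add[OF S] linear_scale[OF S] SSw scaleR_add_right)
    ultimately show ?thesis using that bound m2 by blast
  qed
qed

text \<open>
  Eigenvectors for distinct eigenvalues are orthogonal for \<open>B\<close>, hence linearly independent.
  The maximum over the spectrum is meaningful only because of this finiteness.
\<close>
lemma finite_eigenvalues:
  assumes adj: "\<And>x y. B (S x) y = B x (S y)"
  shows "finite {\<mu>. \<exists>v. v \<noteq> 0 \<and> S v = \<mu> *\<^sub>R v}" (is "finite ?E")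
proof -
  obtain v where v: "\<And>\<mu>. \<mu> \<in> ?E \<Longrightarrow> v \<mu> \<noteq> 0 \<and> S (v \<mu>) = \<mu> *\<^sub>R v \<mu>"
    using bchoice[of ?E "\<lambda>\<mu> v. v \<noteq> 0 \<and> S v = \<mu> *\<^sub>R v"] by auto
  have orth: "B (v \<mu>) (v \<nu>) = 0" if "\<mu> \<in> ?E" "\<nu> \<in> ?E" "\<mu> \<noteq> \<nu>" for \<mu> \<nu>
  proof -
    have "\<mu> * B (v \<mu>) (v \<nu>) = \<nu> * B (v \<mu>) (v \<nu>)"
      using adj[of "v \<mu>" "v \<nu>"] v that by (simp add: scaleR_left scaleR_right)
    then show ?thesis using that by simp
  qed
  have inj: "inj_on v ?E"
  proof (rule inj_onI, rule ccontr)
    fix \<mu> \<nu> assume E: "\<mu> \<in> ?E" "\<nu> \<in> ?E" and eq: "v \<mu> = v \<nu>" and ne: "\<mu> \<noteq> \<nu>"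
    have "B (v \<mu>) (v \<mu>) = 0" using orth[OF E ne] eq by simp
    then show False using v[OF E(1)] by (simp add: eq_zero_iff)
  qed
  have "independent (v ` ?E)"
    unfolding dependent_def
  proof
    assume "\<exists>w\<in>v ` ?E. w \<in> span (v ` ?E - {w})"
    then obtain \<mu> where E: "\<mu> \<in> ?E" and sp: "v \<mu> \<in> span (v ` ?E - {v \<mu>})" by blast
    have "subspace {x. B (v \<mu>) x = 0}"
      by (simp add: subspace_def zero_right add_right scaleR_right)
    moreover have "v ` ?E - {v \<mu>} \<subseteq> {x. B (v \<mu>) x = 0}"
    proof
      fix x assume "x \<in> v ` ?E - {v \<mu>}"
      then obtain \<nu> where \<nu>: "\<nu> \<in> ?E" "x = v \<nu>" "\<mu> \<noteq> \<nu>" by blast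
      show "x \<in> {x. B (v \<mu>) x = 0}" using orth[OF E \<nu>(1,3)] \<nu>(2) by simp
    qed
    ultimately have "span (v ` ?E - {v \<mu>}) \<subseteq> {x. B (v \<mu>) x = 0}"
      by (intro span_minimal)
    then have "v \<mu> \<in> {x. B (v \<mu>) x = 0}" using sp by (rule subsetD)
    then show False using v[OF E] by (simp add: eq_zero_iff)
  qed
  then have "finite (v ` ?E)" by (rule independent_imp_finite)
  then show ?thesis using inj finite_image_iff by blast
qed

section \<open>Convergence by a Lyapunov function\<close>

text \<open>
  Polarization \<open>4 B (P x) y = B (P (x + y)) (x + y) - B (P (x - y)) (x - y)\<close> combined with
  the parallelogram law.
\<close>
lemma form_bound_polarized:
  assumes P: "linear P" and adj: "\<And>x y. B (P x) y = B x (P y)"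
    and bound: "\<And>x. \<bar>B (P x) x\<bar> \<le> c * B x x"
  shows "2 * B (P x) y \<le> c * (B x x + B y y)"
proof -
  have "4 * B (P x) y = B (P (x + y)) (x + y) - B (P (x - y)) (x - y)"
    using adj[of y x] sym[of y "P x"]
    by (simp add: linear_add[OF P] linear_diff[OF P] add_left add_right diff_left diff_right)
  also have "\<dots> \<le> c * B (x + y) (x + y) + c * B (x - y) (x - y)"
    using bound[of "x + y"] bound[of "x - y"] by linarith
  also have "\<dots> = 2 * (c * (B x x + B y y))"
    by (simp add: add_left add_right diff_left diff_right algebra_simps)
  finally show ?thesis by simp
qed

text \<open>
  The Schur-Cohn criterion with an operator coefficient. For a scalar \<open>P\<close> the hypotheses say that
  both roots of \<open>z\<^sup>2 - P z + d\<close> lie in the open unit disc. The Lyapunov function is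
  \<open>V = (1 + d) (B u' u' + B u u) - 2 B (P u') u\<close>: it is positive definite by the bound on \<open>P\<close>, and
  substituting \<open>P u' = u'' + d u\<close> shows that each step lowers it by exactly
  \<open>(1 - d) B (u'' - u) (u'' - u)\<close>. Hence \<open>w = u'' - u\<close> tends to zero. To conclude that \<open>V\<close>
  itself tends to zero, and not merely to some limit, \<open>V\<close> is rewritten as a combination of products
  of differences \<open>w\<close> with the bounded sequence \<open>u\<close>.
\<close>
lemma second_order_recurrence_tendsto_zero:
  assumes P: "linear P" and adj: "\<And>x y. B (P x) y = B x (P y)"
    and bound: "\<And>x. \<bar>B (P x) x\<bar> \<le> c * B x x"
    and c: "c < 1 + d" and d: "d < 1"
    and rec: "\<And>k. u (Suc (Suc k)) = P (u (Suc k)) - d *\<^sub>R u k"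
  shows "u \<longlonglongrightarrow> 0"
proof -
  define V where "V k = (1 + d) * (B (u (Suc k)) (u (Suc k)) + B (u k) (u k))
      - 2 * B (P (u (Suc k))) (u k)" for k
  define w where "w k = u (Suc (Suc k)) - u k" for k
  have Pu: "P (u (Suc k)) = u (Suc (Suc k)) + d *\<^sub>R u k" for k
    by (simp add: rec)
  have lower: "(1 + d - c) * (B (u (Suc k)) (u (Suc k)) + B (u k) (u k)) \<le> V k" for k
    using form_bound_polarized[OF P adj bound, of "u (Suc k)" "u k"]
    by (simp add: V_def left_diff_distrib)
  have lower': "(1 + d - c) * B (u k) (u k) \<le> V k" for k
    using lower[of k] mult_nonneg_nonneg[of "1 + d - c" "B (u (Suc k)) (u (Suc k))"]
      nonneg[of "u (Suc k)"] c
    unfolding distrib_left by linarith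
  have V0: "0 \<le> V k" for k
    using lower'[of k] mult_nonneg_nonneg[of "1 + d - c" "B (u k) (u k)"] nonneg[of "u k"] c
    by linarith
  have step: "V k - V (Suc k) = (1 - d) * B (w k) (w k)" for k
  proof -
    have "B (P (u (Suc (Suc k)))) (u (Suc k)) = B (u (Suc (Suc k))) (u (Suc (Suc k)) + d *\<^sub>R u k)"
      unfolding Pu[symmetric] by (rule adj)
    moreover have "B (P (u (Suc k))) (u k) = B (u (Suc (Suc k)) + d *\<^sub>R u k) (u k)"
      by (simp add: Pu)
    ultimately show ?thesis
      using sym[of "u k" "u (Suc (Suc k))"]
      by (simp add: V_def w_def add_left add_right diff_left diff_right scaleR_left scaleR_right
          algebra_simps)
  qed
  have dec: "decseq V"
  proof (rule decseq_SucI)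
    fix k
    have "0 \<le> (1 - d) * B (w k) (w k)" using d nonneg by simp
    then show "V (Suc k) \<le> V k" using step[of k] by linarith
  qed
  obtain L where L: "V \<longlonglongrightarrow> L" using decseq_convergent[OF dec, of 0] V0 by blast
  have "(\<lambda>k. (V k - V (Suc k)) / (1 - d)) \<longlonglongrightarrow> (L - L) / (1 - d)"
    by (intro tendsto_intros L LIMSEQ_Suc) (use d in simp)
  then have w0: "w \<longlonglongrightarrow> 0"
    using d by (intro tendsto_zeroI) (simp add: step)
  have "B (u k) (u k) \<le> V 0 / (1 + d - c)" for k
    using lower'[of k] decseqD[OF dec, of 0 k] c by (simp add: field_simps)
  then have "Bseq u" by (rule BseqI_form)
  then have bd: "Bseq (\<lambda>k. u (Suc k))" "Bseq (\<lambda>k. u (Suc (Suc k)))"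
    using Bseq_Suc_iff[of u] Bseq_Suc_iff[of "\<lambda>k. u (Suc k)"] by blast+
  have prod0: "(\<lambda>k. B (f k) (g k)) \<longlonglongrightarrow> 0" if "f \<longlonglongrightarrow> 0" "Bseq g" for f g
    using Zfun_prod_Bfun[of f sequentially g] that by (simp add: tendsto_Zfun_iff)
  \<comment> \<open>The cross term \<open>B (P u'') u'\<close> of \<open>V\<close> is evaluated with \<open>P\<close> on either side; subtracting
    each of the two expressions once leaves only products with a difference \<open>w\<close>.\<close>
  have VS: "V (Suc k) = d * B (w k) (u (Suc (Suc k))) - B (w (Suc k)) (u (Suc k))" for k
  proof -
    have 1: "B (P (u (Suc (Suc k)))) (u (Suc k)) = B (u (Suc (Suc k))) (u (Suc (Suc k)) + d *\<^sub>R u k)"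
      unfolding Pu[symmetric] by (rule adj)
    have 2: "B (P (u (Suc (Suc k)))) (u (Suc k)) = B (u (Suc (Suc (Suc k))) + d *\<^sub>R u (Suc k)) (u (Suc k))"
      by (simp only: Pu)
    show ?thesis
      using 1 2 sym[of "u k" "u (Suc (Suc k))"]
      by (simp add: V_def w_def add_left add_right diff_left diff_right scaleR_left scaleR_right
          algebra_simps)
  qed
  have "(\<lambda>k. V (Suc k)) \<longlonglongrightarrow> d * 0 - 0"
    unfolding VS
    by (intro tendsto_intros prod0 w0 LIMSEQ_Suc[OF w0] bd)
  then have "V \<longlonglongrightarrow> 0" by (simp add: filterlim_sequentially_Suc)
  then have "(\<lambda>k. V k / (1 + d - c)) \<longlonglongrightarrow> 0" by (rule tendsto_divide_zero)
  then have "(\<lambda>k. B (u k) (u k)) \<longlonglongrightarrow> 0"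
    by (rule tendsto_sandwich[rotated 3, where f = "\<lambda>_. 0"])
      (use c lower' in \<open>auto simp: field_simps nonneg\<close>)
  then show ?thesis by (rule tendsto_zeroI)
qed

text \<open>
  Both error sequences satisfy the same second-order recurrence with
  \<open>P = 2 (1 - \<alpha>) - \<alpha>\<^sup>2 S\<^sup>2\<close>, the operator analogue of the trace of the iteration matrix. The
  required bounds are the identities \<open>1 + d - 2 (1 - \<alpha>) = \<alpha>\<^sup>2\<close> and
  \<open>1 + d + 2 (1 - \<alpha>) = (2 - \<alpha>)\<^sup>2\<close>: the first makes the upper bound strict, and the second
  turns the lower bound into \<open>\<alpha> \<bar>r\<bar> < 2 - \<alpha>\<close>.
\<close>
lemma gsor_error_tendsto_zero:
  assumes S: "linear S" and adj: "\<And>x y. B (S x) y = B x (S y)"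
    and bound: "\<And>x. B (S x) (S x) \<le> r\<^sup>2 * B x x"
    and \<alpha>: "0 < \<alpha>" "\<alpha> * (1 + \<bar>r\<bar>) < 2"
    and e: "\<And>k. e (Suc k) = (1 - \<alpha>) *\<^sub>R e k + \<alpha> *\<^sub>R S (f k)"
    and f: "\<And>k. f (Suc k) = (1 - \<alpha>) *\<^sub>R f k - \<alpha> *\<^sub>R S (e (Suc k))"
  shows "e \<longlonglongrightarrow> 0" "f \<longlonglongrightarrow> 0"
proof -
  define P where "P x = (2 * (1 - \<alpha>)) *\<^sub>R x - \<alpha>\<^sup>2 *\<^sub>R S (S x)" for x
  define d where "d = (1 - \<alpha>)\<^sup>2"
  \<comment> \<open>The ends of the interval in which \<open>B (P x) x / B x x\<close> must lie, as
    \<open>B (S x) (S x) / B x x\<close> is between \<open>0\<close> and \<open>r\<^sup>2\<close>.\<close>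
  define c where "c = max \<bar>2 * (1 - \<alpha>)\<bar> \<bar>2 * (1 - \<alpha>) - \<alpha>\<^sup>2 * r\<^sup>2\<bar>"
  have linP: "linear P"
    unfolding P_def
    by (intro linear_compose_sub linear_compose_scale_right linear_id[unfolded id_def]
          linear_compose[OF S S, unfolded o_def])
  have adjP: "B (P x) y = B x (P y)" for x y
    by (simp add: P_def diff_left diff_right scaleR_left scaleR_right adj)
  have boundP: "\<bar>B (P x) x\<bar> \<le> c * B x x" for x
  proof -
    have eq: "B (P x) x = 2 * (1 - \<alpha>) * B x x - \<alpha>\<^sup>2 * B (S x) (S x)"
      by (simp add: P_def diff_left scaleR_left adj)
    have "\<alpha>\<^sup>2 * B (S x) (S x) \<le> \<alpha>\<^sup>2 * (r\<^sup>2 * B x x)"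
      by (intro mult_left_mono bound) simp
    then have low: "(2 * (1 - \<alpha>) - \<alpha>\<^sup>2 * r\<^sup>2) * B x x \<le> B (P x) x"
      unfolding eq by (simp add: left_diff_distrib)
    have up: "B (P x) x \<le> 2 * (1 - \<alpha>) * B x x"
      unfolding eq by (simp add: nonneg)
    have "2 * (1 - \<alpha>) * B x x \<le> c * B x x"
      by (intro mult_right_mono nonneg) (simp add: c_def)
    moreover have "- c * B x x \<le> (2 * (1 - \<alpha>) - \<alpha>\<^sup>2 * r\<^sup>2) * B x x"
      by (intro mult_right_mono nonneg) (simp add: c_def)
    ultimately show ?thesis using low up by linarith
  qed
  have "0 \<le> \<alpha> * \<bar>r\<bar>" using \<alpha> by simp
  then have \<alpha>2: "\<alpha> < 2" using \<alpha>(2) by (simp add: distrib_left)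
  have d1: "d < 1"
  proof -
    have "0 < \<alpha> * (2 - \<alpha>)" using \<alpha> \<alpha>2 by simp
    then show ?thesis by (simp add: d_def power2_eq_square algebra_simps)
  qed
  have c1: "c < 1 + d"
  proof -
    have "(\<alpha> * \<bar>r\<bar>)\<^sup>2 < (2 - \<alpha>)\<^sup>2"
      using \<alpha> \<alpha>2 by (intro power_strict_mono) (auto simp: distrib_left)
    then have "\<alpha>\<^sup>2 * r\<^sup>2 < (2 - \<alpha>)\<^sup>2" by (simp add: power_mult_distrib)
    moreover have "0 < \<alpha>\<^sup>2" "0 < (2 - \<alpha>)\<^sup>2" "0 \<le> \<alpha>\<^sup>2 * r\<^sup>2" using \<alpha> \<alpha>2 by simp_all
    moreover have "(2 - \<alpha>)\<^sup>2 = 1 + d + 2 * (1 - \<alpha>)" "\<alpha>\<^sup>2 = 1 + d - 2 * (1 - \<alpha>)"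
      by (simp_all add: d_def power2_eq_square algebra_simps)
    ultimately show ?thesis unfolding c_def by linarith
  qed
  have two: "(2 * (1 - \<alpha>)) *\<^sub>R x = (1 - \<alpha>) *\<^sub>R x + (1 - \<alpha>) *\<^sub>R x" for x :: 'a
    by (simp only: mult_2 scaleR_add_left)
  have "e (Suc (Suc k)) = P (e (Suc k)) - d *\<^sub>R e k" for k
  proof -
    have 1: "\<alpha> *\<^sub>R S (f k) = e (Suc k) - (1 - \<alpha>) *\<^sub>R e k" by (simp add: e)
    have 2: "\<alpha> *\<^sub>R S (f (Suc k)) = (1 - \<alpha>) *\<^sub>R (\<alpha> *\<^sub>R S (f k)) - \<alpha>\<^sup>2 *\<^sub>R S (S (e (Suc k)))"
      by (simp add: f[of k] linear_diff[OF S] linear_scale[OF S] scaleR_diff_right power2_eq_square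
          mult.commute)
    then show ?thesis
      unfolding e[of "Suc k"] 2 1 P_def d_def two
      by (simp add: algebra_simps power2_eq_square) (simp only: mult_2_right scaleR_add_left)
  qed
  then show "e \<longlonglongrightarrow> 0"
    by (rule second_order_recurrence_tendsto_zero[OF linP adjP boundP c1 d1])
  have "f (Suc (Suc k)) = P (f (Suc k)) - d *\<^sub>R f k" for k
  proof -
    have 1: "\<alpha> *\<^sub>R S (e (Suc k)) = (1 - \<alpha>) *\<^sub>R f k - f (Suc k)" by (simp add: f)
    have 2: "\<alpha> *\<^sub>R S (e (Suc (Suc k)))
        = (1 - \<alpha>) *\<^sub>R (\<alpha> *\<^sub>R S (e (Suc k))) + \<alpha>\<^sup>2 *\<^sub>R S (S (f (Suc k)))"
      by (simp add: e[of "Suc k"] linear_add[OF S] linear_scale[OF S] scaleR_add_right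
          power2_eq_square mult.commute)
    then show ?thesis
      unfolding f[of "Suc k"] 2 1 P_def d_def two
      by (simp add: algebra_simps power2_eq_square) (simp only: mult_2_right scaleR_add_left)
  qed
  then show "f \<longlonglongrightarrow> 0"
    by (rule second_order_recurrence_tendsto_zero[OF linP adjP boundP c1 d1])
qed

end

section \<open>Divergence along an eigenvector\<close>
lemma abs_less_one_if_powers_tendsto_zero:
  fixes l :: real
  assumes "(\<lambda>k. l ^ k) \<longlonglongrightarrow> 0"
  shows "\<bar>l\<bar> < 1"
proof -
  have "eventually (\<lambda>k. norm (l ^ k) < 1) sequentially"
    using order_tendstoD(2)[OF tendsto_norm_zero[OF assms], of 1] by simp
  then obtain k where "\<bar>l\<bar> ^ k < 1"
    by (auto simp: eventually_sequentially power_abs)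
  then show ?thesis using one_le_power[of "\<bar>l\<bar>" k] by linarith
qed

text \<open>
  The errors along an eigenvector of \<open>S\<close> for the eigenvalue \<open>\<mu>\<close>. The determinant formed from two
  solutions is multiplied by \<open>(1 - \<alpha>)\<^sup>2\<close> in each step; as it tends to zero, \<open>0 < \<alpha> < 2\<close>.
  If \<open>\<alpha> \<bar>\<mu>\<bar> \<ge> 2 - \<alpha>\<close>, the characteristic polynomial \<open>z\<^sup>2 - t z + d\<close> takes the value
  \<open>1 + t + d \<le> 0\<close> at \<open>-1\<close>, so it has a root \<open>l \<le> -1\<close>, and the geometric solution with ratio
  \<open>l\<close> does not tend to zero.
\<close>
lemma scalar_gsor_necessary:
  fixes \<alpha> \<mu> :: real
  assumes conv: "\<And>a b :: nat \<Rightarrow> real.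
      (\<And>k. a (Suc k) = (1 - \<alpha>) * a k + \<alpha> * \<mu> * b k) \<Longrightarrow>
      (\<And>k. b (Suc k) = (1 - \<alpha>) * b k - \<alpha> * \<mu> * a (Suc k)) \<Longrightarrow>
      a \<longlonglongrightarrow> 0 \<and> b \<longlonglongrightarrow> 0"
  shows "0 < \<alpha>" "\<alpha> * (1 + \<bar>\<mu>\<bar>) < 2"
proof -
  define F where "F = (\<lambda>(a, b). let a' = (1 - \<alpha>) * a + \<alpha> * \<mu> * b
      in (a', (1 - \<alpha>) * b - \<alpha> * \<mu> * a'))"
  define z where "z u k = (F ^^ k) u" for u k
  have recs: "fst (z u (Suc k)) = (1 - \<alpha>) * fst (z u k) + \<alpha> * \<mu> * snd (z u k)"
    "snd (z u (Suc k)) = (1 - \<alpha>) * snd (z u k) - \<alpha> * \<mu> * fst (z u (Suc k))" for u k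
    by (simp_all add: z_def F_def case_prod_unfold Let_def)
  have lim: "(\<lambda>k. fst (z u k)) \<longlonglongrightarrow> 0" "(\<lambda>k. snd (z u k)) \<longlonglongrightarrow> 0" for u
    using conv[of "\<lambda>k. fst (z u k)" "\<lambda>k. snd (z u k)"] recs by auto
  have wronskian: "fst (z (1,0) k) * snd (z (0,1) k) - snd (z (1,0) k) * fst (z (0,1) k)
      = ((1 - \<alpha>)\<^sup>2) ^ k" for k
  proof (induction k)
    case 0
    show ?case by (simp add: z_def)
  next
    case (Suc k)
    show ?case
      unfolding recs power_Suc Suc[symmetric] by (simp add: algebra_simps power2_eq_square)
  qed
  have "(\<lambda>k. ((1 - \<alpha>)\<^sup>2) ^ k) \<longlonglongrightarrow> 0 * 0 - 0 * 0"
    unfolding wronskian[symmetric] by (intro tendsto_intros lim)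
  then have det: "(1 - \<alpha>)\<^sup>2 < 1"
    using abs_less_one_if_powers_tendsto_zero[of "(1 - \<alpha>)\<^sup>2"] by simp
  then have "\<bar>1 - \<alpha>\<bar> < 1" by (simp add: abs_square_less_1)
  then show \<alpha>0: "0 < \<alpha>" by simp
  have \<alpha>2: "\<alpha> < 2" using \<open>\<bar>1 - \<alpha>\<bar> < 1\<close> by simp
  show "\<alpha> * (1 + \<bar>\<mu>\<bar>) < 2"
  proof (rule ccontr)
    assume "\<not> ?thesis"
    then have big: "2 - \<alpha> \<le> \<alpha> * \<bar>\<mu>\<bar>" by (simp add: distrib_left)
    define t where "t = 2 * (1 - \<alpha>) - (\<alpha> * \<mu>)\<^sup>2"
    define d where "d = (1 - \<alpha>)\<^sup>2"
    have "(2 - \<alpha>)\<^sup>2 \<le> (\<alpha> * \<bar>\<mu>\<bar>)\<^sup>2" using big \<alpha>2 by (intro power_mono) auto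
    then have t: "t \<le> - (1 + d)"
      by (simp add: t_def d_def power_mult_distrib) (simp add: power2_eq_square algebra_simps)
    have d0: "0 \<le> d" by (simp add: d_def)
    have disc: "(t + 2)\<^sup>2 \<le> t\<^sup>2 - 4 * d"
      using t by (simp add: power2_eq_square algebra_simps)
    then have disc0: "0 \<le> t\<^sup>2 - 4 * d" using zero_le_power2[of "t + 2"] by linarith
    define l where "l = (t - sqrt (t\<^sup>2 - 4 * d)) / 2"
    have "t + 2 \<le> sqrt (t\<^sup>2 - 4 * d)" using disc by (rule real_le_rsqrt)
    then have l: "l \<le> -1" by (simp add: l_def)
    have "(2 * l - t)\<^sup>2 = t\<^sup>2 - 4 * d" using disc0 by (simp add: l_def diff_divide_distrib)
    then have root: "l * l = t * l - d" by (simp add: power2_eq_square algebra_simps)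
    \<comment> \<open>The initial values \<open>\<alpha> \<mu>\<close> and \<open>l - (1 - \<alpha>)\<close> form an eigenvector of the iteration
      matrix for \<open>l\<close>: they solve the first equation of the recursion with ratio \<open>l\<close>.\<close>
    let ?a = "\<lambda>k. \<alpha> * \<mu> * l ^ k" and ?b = "\<lambda>k. (l - (1 - \<alpha>)) * l ^ k"
    have "?b (Suc k) = (1 - \<alpha>) * ?b k - \<alpha> * \<mu> * ?a (Suc k)" for k
    proof -
      have "(l - (1 - \<alpha>)) * l = (1 - \<alpha>) * (l - (1 - \<alpha>)) - (\<alpha> * \<mu>)\<^sup>2 * l"
        using root by (simp add: t_def d_def power2_eq_square algebra_simps)
      then have "((l - (1 - \<alpha>)) * l) * l ^ k = ((1 - \<alpha>) * (l - (1 - \<alpha>)) - (\<alpha> * \<mu>)\<^sup>2 * l) * l ^ k"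
        by simp
      then show ?thesis by (simp add: power2_eq_square algebra_simps)
    qed
    then have "?a \<longlonglongrightarrow> 0"
      using conv[of ?a ?b] by (simp add: algebra_simps)
    moreover have "\<alpha> * \<mu> \<noteq> 0" using big \<alpha>2 by auto
    ultimately have "(\<lambda>k. l ^ k) \<longlonglongrightarrow> 0"
      using tendsto_mult_left_iff[of "\<alpha> * \<mu>" "\<lambda>k. l ^ k" 0] by simp
    then have "\<bar>l\<bar> < 1" by (rule abs_less_one_if_powers_tendsto_zero)
    then show False using l by simp
  qed
qed

section \<open>Matrices\<close>

lemma symmetric_mat_inner:
  fixes A :: "real^'n^'n"
  assumes "symmetric_mat A"
  shows "x \<bullet> (A *v y) = y \<bullet> (A *v x)"
  using assms by (metis dot_lmul_matrix inner_commute symmetric_mat_def transpose_matrix_vector)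
lemma definite_form_pos_def_mat:
  fixes W :: "real^'n^'n"
  assumes "symmetric_mat W" "pos_def_mat W"
  shows "definite_form (\<lambda>x y. x \<bullet> (W *v y))"
proof (intro definite_form.intro definite_form_axioms.intro)
  show "bounded_bilinear (\<lambda>x y. x \<bullet> (W *v y))"
    by (rule bounded_bilinear.comp[OF bounded_bilinear_inner bounded_linear_ident
          matrix_vector_mul_bounded_linear])
  show "x \<bullet> (W *v y) = y \<bullet> (W *v x)" for x y
    using assms(1) by (rule symmetric_mat_inner)
  show "x \<noteq> 0 \<Longrightarrow> 0 < x \<bullet> (W *v x)" for x
    using assms(2) by (simp add: pos_def_mat_def)
qed

lemma complex_eigenvector_parts:
  fixes A :: "real^'n^'n" and v :: "complex^'n"
  assumes "map_matrix complex_of_real A *v v = z *s v"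
  defines "x \<equiv> \<chi> i. Re (v $ i)" and "y \<equiv> \<chi> i. Im (v $ i)"
  shows "A *v x = Re z *\<^sub>R x - Im z *\<^sub>R y" "A *v y = Im z *\<^sub>R x + Re z *\<^sub>R y"
proof -
  have "(\<Sum>j\<in>UNIV. complex_of_real (A $ i $ j) * v $ j) = z * v $ i" for i
    using arg_cong[OF assms(1), of "\<lambda>u. u $ i"]
    by (simp add: matrix_vector_mult_def map_matrix_def)
  note Re_Im = this[THEN arg_cong, of Re] this[THEN arg_cong, of Im]
  show "A *v x = Re z *\<^sub>R x - Im z *\<^sub>R y" "A *v y = Im z *\<^sub>R x + Re z *\<^sub>R y"
    using Re_Im by (simp_all add: vec_eq_iff matrix_vector_mult_def x_def y_def algebra_simps)
qed

lemma real_eigenvalue_in_spectrum: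
  fixes A :: "real^'n^'n"
  assumes "v \<noteq> 0" "A *v v = \<mu> *\<^sub>R v"
  shows "complex_of_real \<mu> \<in> spectrum_mat A"
proof -
  let ?w = "\<chi> i. complex_of_real (v $ i)"
  have "(\<Sum>j\<in>UNIV. A $ i $ j * v $ j) = \<mu> * v $ i" for i
    using arg_cong[OF assms(2), of "\<lambda>u. u $ i"] by (simp add: matrix_vector_mult_def)
  then have "map_matrix complex_of_real A *v ?w = complex_of_real \<mu> *s ?w"
    by (simp add: vec_eq_iff matrix_vector_mult_def map_matrix_def flip: of_real_mult of_real_sum)
  moreover have "?w \<noteq> 0" using assms(1) by (auto simp: vec_eq_iff)
  ultimately show ?thesis unfolding spectrum_mat_def by blast
qed

text \<open>
  The spectrum consists of complex eigenvalues, whereas self-adjointness and the extremal bound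
  concern real vectors. Splitting a complex eigenvector into real and imaginary part \<open>x\<close>, \<open>y\<close>
  and comparing \<open>B (A x) y\<close> with \<open>B x (A y)\<close> gives \<open>Im z (B x x + B y y) = 0\<close>. So every
  eigenvalue is real with a real eigenvector, and the extremal bound applies to it.
\<close>
lemma spectral_radius_extremal:
  fixes A :: "real^'n^'n"
  assumes form: "definite_form B" and adj: "\<And>x y. B (A *v x) y = B x (A *v y)"
    and v: "v \<noteq> 0" "A *v v = \<mu> *\<^sub>R v"
    and bound: "\<And>x. B (A *v x) (A *v x) \<le> \<mu>\<^sup>2 * B x x"
  shows "spectral_radius_mat A = \<bar>\<mu>\<bar>"
proof -
  interpret definite_form B by (rule form)
  let ?E = "{\<nu>. \<exists>u. u \<noteq> 0 \<and> A *v u = \<nu> *\<^sub>R u}"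
  have real: "\<exists>\<nu>\<in>?E. z = complex_of_real \<nu>" if z: "z \<in> spectrum_mat A" for z
  proof -
    obtain w where w: "w \<noteq> 0" "map_matrix complex_of_real A *v w = z *s w"
      using z by (auto simp: spectrum_mat_def)
    define x y where "x = (\<chi> i. Re (w $ i))" and "y = (\<chi> i. Im (w $ i))"
    have xy: "A *v x = Re z *\<^sub>R x - Im z *\<^sub>R y" "A *v y = Im z *\<^sub>R x + Re z *\<^sub>R y"
      using complex_eigenvector_parts[OF w(2)] by (simp_all add: x_def y_def)
    have nz: "x \<noteq> 0 \<or> y \<noteq> 0"
      using w(1) by (auto simp: x_def y_def vec_eq_iff complex_eq_iff)
    have "Im z * (B x x + B y y) = 0"
      using adj[of x y]
      by (simp add: xy diff_left add_right scaleR_left scaleR_right algebra_simps)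
    moreover have "B x x + B y y > 0"
      using nz pos[of x] pos[of y] nonneg[of x] nonneg[of y] by linarith
    ultimately have im: "Im z = 0" by simp
    then have "A *v x = Re z *\<^sub>R x" "A *v y = Re z *\<^sub>R y" using xy by simp_all
    then have "Re z \<in> ?E" using nz by blast
    moreover have "z = complex_of_real (Re z)" using im by (simp add: complex_eq_iff)
    ultimately show ?thesis by blast
  qed
  have "spectrum_mat A \<subseteq> complex_of_real ` ?E" using real by blast
  then have fin: "finite (spectrum_mat A)"
    using finite_eigenvalues[OF adj] finite_surj by blast
  have "norm z \<le> \<bar>\<mu>\<bar>" if z: "z \<in> spectrum_mat A" for z
  proof -
    obtain \<nu> u where u: "z = complex_of_real \<nu>" "u \<noteq> 0" "A *v u = \<nu> *\<^sub>R u"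
      using real[OF z] by blast
    have "\<nu>\<^sup>2 * B u u \<le> \<mu>\<^sup>2 * B u u"
      using bound[of u] u(3) by (simp add: scaleR_left scaleR_right power2_eq_square)
    then have "\<nu>\<^sup>2 \<le> \<mu>\<^sup>2" using pos[OF u(2)] by simp
    then show ?thesis by (simp add: u(1) abs_le_square_iff)
  qed
  moreover have "\<bar>\<mu>\<bar> \<in> norm ` spectrum_mat A"
    using real_eigenvalue_in_spectrum[OF v] by (metis imageI norm_of_real real_norm_def)
  ultimately show ?thesis
    unfolding spectral_radius_mat_def by (intro Max_eqI) (use fin in auto)
qed

lemma matrix_inv_right:
  fixes W :: "real^'n^'n"
  assumes "invertible W"
  shows "W ** matrix_inv W = mat 1"
  unfolding matrix_inv_def
  by (rule conjunct1[OF someI_ex[OF assms[unfolded invertible_def]]])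

section \<open>The block system and its iteration\<close>

text \<open>
  If \<open>(x, y)\<close> solves the homogeneous system, then adding the inner product of the first equation
  with \<open>x\<close> and of the second with \<open>y\<close> cancels the terms in \<open>T\<close> by symmetry and leaves
  \<open>x \<bullet> W x + y \<bullet> W y = 0\<close>. So the block matrix is injective, hence surjective.
\<close>
lemma block_solution_exists:
  fixes W T :: "real^'n^'n"
  assumes "pos_def_mat W" "symmetric_mat T"
  obtains xs ys where "block_solution W T p q xs ys"
proof -
  let ?F = "\<lambda>(x, y). (W *v x - T *v y, T *v x + W *v y)"
  have lin: "linear ?F"
    by (rule linearI)
      (auto simp: matrix_vector_right_distrib matrix_vector_mult_scaleR algebra_simps)
  have "u = 0" if u: "?F u = 0" for u
  proof -
    obtain x y where [simp]: "u = (x, y)" by (cases u)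
    have eqs: "W *v x = T *v y" "W *v y = - (T *v x)"
      using u by (auto simp: zero_prod_def add_eq_0_iff)
    have "y \<bullet> (T *v x) = x \<bullet> (T *v y)"
      using assms(2) by (rule symmetric_mat_inner)
    then have "x \<bullet> (W *v x) + y \<bullet> (W *v y) = 0" using eqs by simp
    moreover have "0 < z \<bullet> (W *v z) \<or> z = 0" "0 \<le> z \<bullet> (W *v z)" for z
      using assms(1) by (auto simp: pos_def_mat_def intro: less_imp_le)
        (metis inner_zero_left less_eq_real_def)
    ultimately have "x = 0" "y = 0" by (smt (verit))+
    then show ?thesis by (simp add: zero_prod_def)
  qed
  then have "inj ?F" using lin by (simp add: linear_injective_0)
  then have "surj ?F" using lin linear_injective_imp_surjective by blast
  then obtain u where "(p, q) = ?F u" by (rule surjE)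
  then have "block_solution W T p q (fst u) (snd u)"
    by (simp add: block_solution_def case_prod_unfold)
  then show thesis by (rule that)
qed

lemma gsor_iterates_iff_error:
  fixes W T :: "real^'n^'n"
  assumes W: "invertible W" and sol: "block_solution W T p q xs ys"
  shows "gsor_iterates W T \<alpha> p q x y \<longleftrightarrow>
    (\<forall>k. x (Suc k) - xs = (1 - \<alpha>) *\<^sub>R (x k - xs) + \<alpha> *\<^sub>R (matrix_inv W ** T *v (y k - ys)) \<and>
         y (Suc k) - ys = (1 - \<alpha>) *\<^sub>R (y k - ys) - \<alpha> *\<^sub>R (matrix_inv W ** T *v (x (Suc k) - xs)))"
proof -
  have WS: "W *v (matrix_inv W ** T *v v) = T *v v" for v
    using matrix_inv_right[OF W] by (simp add: matrix_vector_mul_assoc matrix_mul_assoc)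
  \<comment> \<open>The residual of each iteration equation is \<open>W\<close> applied to that of the error equation.\<close>
  have residual: "a = b \<longleftrightarrow> c = e" if "a - b = W *v (c - e)" for a b c e :: "real^'n"
  proof -
    have "W *v u = 0 \<longleftrightarrow> u = 0" for u
      using inj_matrix_vector_mult[OF W] by (metis injD matrix_vector_mult_0_right)
    then show ?thesis using that by (metis right_minus_eq)
  qed
  have pq: "p = W *v xs - T *v ys" "q = T *v xs + W *v ys"
    using sol by (simp_all add: block_solution_def)
  show ?thesis
    unfolding gsor_iterates_def pq
    by (intro all_cong1 arg_cong2[where f = "(\<and>)"] residual)
      (simp_all add: WS matrix_vector_right_distrib matrix_vector_mult_diff_distrib
        matrix_vector_mult_scaleR algebra_simps)
qed

theorem theorem1:
  fixes W T S :: "real^'n^'n" and p q :: "real^'n" and \<alpha> :: real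
  assumes "symmetric_mat W" and "pos_def_mat W"
    and "symmetric_mat T"
    and "S = matrix_inv W ** T"
    and "\<alpha> \<noteq> 0"
  shows "gsor_convergent W T \<alpha> p q \<longleftrightarrow>
    0 < \<alpha> \<and> \<alpha> < 2 / (1 + spectral_radius_mat S)"
proof -
  let ?B = "\<lambda>x y. x \<bullet> (W *v y)"
  have inv: "invertible W" using assms(2) by (rule pos_def_mat_invertible)
  have form: "definite_form ?B" using assms(1,2) by (rule definite_form_pos_def_mat)
  interpret definite_form ?B by (rule form)
  have WS: "W *v (S *v v) = T *v v" for v
    using matrix_inv_right[OF inv] by (simp add: assms(4) matrix_vector_mul_assoc matrix_mul_assoc)
  have adj: "?B (S *v x) y = ?B x (S *v y)" for x y
  proof -
    have "?B (S *v x) y = y \<bullet> (T *v x)" using sym[of "S *v x" y] by (simp add: WS)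
    also have "\<dots> = x \<bullet> (T *v y)"
      using assms(3) by (rule symmetric_mat_inner)
    finally show ?thesis by (simp add: WS)
  qed
  have lin: "linear ((*v) S)" by (rule matrix_vector_mul_linear)
  obtain \<mu> v where v: "v \<noteq> 0" "S *v v = \<mu> *\<^sub>R v"
    and bound: "\<And>x. ?B (S *v x) (S *v x) \<le> \<mu>\<^sup>2 * ?B x x"
    using extremal_eigenvector[OF lin adj] by blast
  have rho: "spectral_radius_mat S = \<bar>\<mu>\<bar>"
    by (rule spectral_radius_extremal[OF form adj v bound])
  have range: "\<alpha> < 2 / (1 + spectral_radius_mat S) \<longleftrightarrow> \<alpha> * (1 + \<bar>\<mu>\<bar>) < 2"
    by (simp add: rho pos_less_divide_eq)
  show ?thesis
    unfolding range
  proof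
    assume "gsor_convergent W T \<alpha> p q"
    then obtain xs ys where sol: "block_solution W T p q xs ys"
      and conv: "\<And>x y. gsor_iterates W T \<alpha> p q x y \<Longrightarrow> x \<longlonglongrightarrow> xs \<and> y \<longlonglongrightarrow> ys"
      unfolding gsor_convergent_def by blast
    have coef: "a \<longlonglongrightarrow> 0" if "(\<lambda>k. z + a k *\<^sub>R v) \<longlonglongrightarrow> z" for a :: "nat \<Rightarrow> real" and z
    proof -
      have "(\<lambda>k. (z + a k *\<^sub>R v) - z) \<longlonglongrightarrow> z - z" by (intro tendsto_intros that)
      then have "(\<lambda>k. \<bar>a k\<bar> * norm v) \<longlonglongrightarrow> 0" using tendsto_norm_zero by fastforce
      then show ?thesis using v(1) tendsto_mult_right_iff[of "norm v" "\<lambda>k. \<bar>a k\<bar>" 0]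
        by (simp add: tendsto_rabs_zero_iff)
    qed
    have "a \<longlonglongrightarrow> 0 \<and> b \<longlonglongrightarrow> 0"
      if a: "\<And>k. a (Suc k) = (1 - \<alpha>) * a k + \<alpha> * \<mu> * b k"
        and b: "\<And>k. b (Suc k) = (1 - \<alpha>) * b k - \<alpha> * \<mu> * a (Suc k)" for a b :: "nat \<Rightarrow> real"
    proof -
      have "gsor_iterates W T \<alpha> p q (\<lambda>k. xs + a k *\<^sub>R v) (\<lambda>k. ys + b k *\<^sub>R v)"
        unfolding gsor_iterates_iff_error[OF inv sol] assms(4)[symmetric]
        by (simp add: matrix_vector_mult_scaleR v(2) b)
           (simp add: a algebra_simps)
      then show ?thesis using conv coef by blast
    qed
    then show "0 < \<alpha> \<and> \<alpha> * (1 + \<bar>\<mu>\<bar>) < 2"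
      using scalar_gsor_necessary[of \<alpha> \<mu>] by blast
  next
    assume \<alpha>: "0 < \<alpha> \<and> \<alpha> * (1 + \<bar>\<mu>\<bar>) < 2"
    obtain xs ys where sol: "block_solution W T p q xs ys"
      using block_solution_exists[OF assms(2,3)] .
    have "x \<longlonglongrightarrow> xs \<and> y \<longlonglongrightarrow> ys" if "gsor_iterates W T \<alpha> p q x y" for x y
    proof -
      have rec: "\<And>k. x (Suc k) - xs = (1 - \<alpha>) *\<^sub>R (x k - xs) + \<alpha> *\<^sub>R (S *v (y k - ys))"
        "\<And>k. y (Suc k) - ys = (1 - \<alpha>) *\<^sub>R (y k - ys) - \<alpha> *\<^sub>R (S *v (x (Suc k) - xs))"
        using that unfolding gsor_iterates_iff_error[OF inv sol] assms(4)[symmetric] by blast+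
      have "(\<lambda>k. x k - xs) \<longlonglongrightarrow> 0" "(\<lambda>k. y k - ys) \<longlonglongrightarrow> 0"
        using gsor_error_tendsto_zero[OF lin adj bound, of \<alpha> "\<lambda>k. x k - xs" "\<lambda>k. y k - ys"] rec \<alpha>
        by blast+
      then show ?thesis by (simp add: LIM_zero_iff)
    qed
    then show "gsor_convergent W T \<alpha> p q"
      unfolding gsor_convergent_def using sol by blast
  qed
qed

end
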